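(* Let $D$ be a finite digraph that contains no blocking odd cycle as an induced subdigraph, and suppose that the underlying graph $U(D)$ is perfect. Then $D$ is BE-diperfect.
   Context: Digraphs have no loops and no parallel arcs, but may contain both arcs $uv$ and $vu$ (cycles of length two). Two vertices $u,v$ are adjacent if $uv$ or $vu$ is an arc. $U(D)$ is the simple graph on $V(D)$ whose edges are the pairs of vertices adjacent in $D$. A stable set is a set of pairwise non-adjacent vertices; it is maximum if no stable set has larger cardinality. A path of $D$ is a directed path, i.e. a sequence $v_1v_2\cdots v_\ell$ of distinct vertices ($\ell\ge 1$) with $v_iv_{i+1}\in A(D)$ for $1\le i<\ell$. A path partition of $D$ is a collection of paths whose vertex sets partition $V(D)$. For a stable set $S$, an $S_{\rm BE}$-path partition of $D$ is a path partition $\mathcal P$ such that every $P=x_1x_2\cdots x_k\in\mathcal P$ satisfies $V(P)\cap S=\{x\}$ with $x\in\{x_1,x_k\}$. A digraph satisfies the BE-property if it has an $S_{\rm BE}$-path partition for every maximum stable set $S$. A digraph is BE-diperfect if every induced subdigraph of it satisfies the BE-property. A source is a vertex with no in-neighbor, a sink is a vertex with no out-neighbor. A digraph $C$ is a blocking odd cycle if $U(C)$ is a cycle $x_1x_2\cdots x_{2k+1}x_1$ for some integer $k\ge 1$, and each of $x_1$ and $x_2$ is either a source or a sink in $C$. A graph $G$ is perfect if for every induced subgraph $H$ of $G$ the chromatic number of $H$ equals the size of a largest clique of $H$. *)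

theory Defs
  imports "Graph_Theory.Graph_Theory" "HOL-Library.Disjoint_Sets"
begin

text \<open>
  The locale \<^locale>\<open>digraph\<close> describes finite digraphs without loops and without parallel
  arcs; both arcs between two vertices are allowed. Undirected simple graphs are
  symmetric digraphs: the edge between \<open>u\<close> and \<open>v\<close> is represented by the two
  arcs \<open>(u, v)\<close> and \<open>(v, u)\<close>. In particular \<^const>\<open>mk_symmetric\<close> is the underlying simple graph.
\<close>

definition adjacent :: "('a, 'b) pre_digraph \<Rightarrow> 'a \<Rightarrow> 'a \<Rightarrow> bool" where
  "adjacent G u v \<longleftrightarrow> u \<rightarrow>\<^bsub>G\<^esub> v \<or> v \<rightarrow>\<^bsub>G\<^esub> u"

abbreviation underlying_graph :: "('a, 'b) pre_digraph \<Rightarrow> ('a, 'a \<times> 'a) pre_digraph" where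
  "underlying_graph G \<equiv> with_proj (mk_symmetric G)"

lemma arcs_ends_underlying_graph: "u \<rightarrow>\<^bsub>underlying_graph G\<^esub> v \<longleftrightarrow> adjacent G u v"
  by (auto simp: mk_symmetric_def adjacent_def arcs_ends_conv)

lemma graph_underlying_graph:
  assumes "digraph G"
  shows "graph (underlying_graph G)"
proof -
  interpret digraph G by fact
  have "pair_graph (mk_symmetric G)"
    by unfold_locales (auto simp: mk_symmetric_def symmetric_def sym_def dest: no_loops)
  then show ?thesis
    by (rule pair_graph.pair_graphD_graph)
qed

definition stable_set :: "('a, 'b) pre_digraph \<Rightarrow> 'a set \<Rightarrow> bool" where
  "stable_set G S \<longleftrightarrow> S \<subseteq> verts G \<and> pairwise (\<lambda>u v. \<not> adjacent G u v) S"

definition maximum_stable_set :: "('a, 'b) pre_digraph \<Rightarrow> 'a set \<Rightarrow> bool" where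
  "maximum_stable_set G S \<longleftrightarrow> stable_set G S \<and> (\<forall>T. stable_set G T \<longrightarrow> card T \<le> card S)"

text \<open>
  Directed paths are given by their vertex lists (\<^const>\<open>vpath\<close>; nonempty, repetition-free).
  The injectivity condition excludes two different paths with the same vertex set, which
  \<^const>\<open>partition_on\<close> alone would not see.
\<close>

definition path_partition :: "('a, 'b) pre_digraph \<Rightarrow> 'a list set \<Rightarrow> bool" where
  "path_partition G P \<longleftrightarrow>
     (\<forall>p\<in>P. vpath p G) \<and> inj_on set P \<and> partition_on (verts G) (set ` P)"

definition BE_path_partition :: "('a, 'b) pre_digraph \<Rightarrow> 'a set \<Rightarrow> 'a list set \<Rightarrow> bool" where
  "BE_path_partition G S P \<longleftrightarrow>
     path_partition G P \<and> (\<forall>p\<in>P. \<exists>x. set p \<inter> S = {x} \<and> x \<in> {hd p, last p})"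

definition BE_property :: "('a, 'b) pre_digraph \<Rightarrow> bool" where
  "BE_property G \<longleftrightarrow> (\<forall>S. maximum_stable_set G S \<longrightarrow> (\<exists>P. BE_path_partition G S P))"

definition BE_diperfect :: "('a, 'b) pre_digraph \<Rightarrow> bool" where
  "BE_diperfect G \<longleftrightarrow> (\<forall>H. induced_subgraph H G \<longrightarrow> BE_property H)"

definition source :: "('a, 'b) pre_digraph \<Rightarrow> 'a \<Rightarrow> bool" where
  "source G v \<longleftrightarrow> v \<in> verts G \<and> \<not> (\<exists>u. u \<rightarrow>\<^bsub>G\<^esub> v)"

definition sink :: "('a, 'b) pre_digraph \<Rightarrow> 'a \<Rightarrow> bool" where
  "sink G v \<longleftrightarrow> v \<in> verts G \<and> \<not> (\<exists>u. v \<rightarrow>\<^bsub>G\<^esub> u)"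

text \<open>
  The whole graph \<open>G\<close> is the cycle through \<open>xs\<close>: there are no further vertices and no chords.
\<close>

definition is_cycle_graph :: "('a, 'b) pre_digraph \<Rightarrow> 'a list \<Rightarrow> bool" where
  "is_cycle_graph G xs \<longleftrightarrow>
     3 \<le> length xs \<and> distinct xs \<and> verts G = set xs \<and>
     arcs_ends G = (\<Union>i<length xs. {(xs ! i, xs ! (Suc i mod length xs)),
                                    (xs ! (Suc i mod length xs), xs ! i)})"

text \<open>The vertices \<open>x\<^sub>1\<close> and \<open>x\<^sub>2\<close> of the cycle are \<open>xs ! 0\<close> and \<open>xs ! 1\<close>.\<close>

definition blocking_odd_cycle :: "('a, 'b) pre_digraph \<Rightarrow> bool" where
  "blocking_odd_cycle C \<longleftrightarrow> digraph C \<and>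
     (\<exists>k xs. 1 \<le> k \<and> length xs = 2 * k + 1 \<and> is_cycle_graph (underlying_graph C) xs \<and>
       (source C (xs ! 0) \<or> sink C (xs ! 0)) \<and> (source C (xs ! 1) \<or> sink C (xs ! 1)))"

definition clique_set :: "('a, 'b) pre_digraph \<Rightarrow> 'a set \<Rightarrow> bool" where
  "clique_set G K \<longleftrightarrow> K \<subseteq> verts G \<and> pairwise (adjacent G) K"

definition proper_colouring :: "('a, 'b) pre_digraph \<Rightarrow> ('a \<Rightarrow> nat) \<Rightarrow> bool" where
  "proper_colouring G c \<longleftrightarrow> (\<forall>u\<in>verts G. \<forall>v\<in>verts G. adjacent G u v \<longrightarrow> c u \<noteq> c v)"

text \<open>
  Both numbers are meaningful for finite loopfree graphs only; they are \<open>0\<close> for the null graph.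
\<close>

definition clique_number :: "('a, 'b) pre_digraph \<Rightarrow> nat" where
  "clique_number G = Max {card K | K. clique_set G K}"

definition chromatic_number :: "('a, 'b) pre_digraph \<Rightarrow> nat" where
  "chromatic_number G = (LEAST n. \<exists>c. proper_colouring G c \<and> c ` verts G \<subseteq> {..<n})"

definition perfect_graph :: "('a, 'b) pre_digraph \<Rightarrow> bool" where
  "perfect_graph G \<longleftrightarrow>
     graph G \<and> (\<forall>H. induced_subgraph H G \<longrightarrow> chromatic_number H = clique_number H)"

end

theory Submission
  imports Defs
begin

text \<open>
  It suffices to partition the vertex set into cliques that each contain exactly one vertex of the
  given maximum stable set \<open>S\<close>, and to find in each of these cliques a Hamiltonian path that starts or
  ends at its vertex of \<open>S\<close>.

  The partition is Lovasz's theorem that the complement of a perfect graph is perfect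
  (\<open>clique_partition\<close>). It is obtained by removing, again and again, a clique that meets every
  maximum stable set (\<open>clique_meeting_maximum_stable_sets\<close>). If there were no such clique, one could
  choose for every clique a maximum stable set missing it; weighting each vertex by the number of
  chosen sets that contain it and colouring the weighted graph leads to a counting contradiction.
  That perfect graphs admit such weighted colourings is the replication lemma
  (\<open>weighted_colouring\<close>).

  For the paths, the only blocking odd cycles that matter are triangles: a blocking triangle
  is exactly a transitive tournament on three vertices. In a clique, if every vertex is reachable from
  \<open>s\<close>, then a path starting at \<open>s\<close> can be extended, one vertex at a time, to a Hamiltonian one
  (\<open>hamiltonian_path_from\<close>); dually if \<open>s\<close> is reachable from every vertex. If both fail, then a vertex
  \<open>u\<close> unreachable from \<open>s\<close>, the vertex \<open>s\<close>, and a vertex \<open>v\<close> from which \<open>s\<close> is unreachable form a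
  transitive triangle with arcs \<open>us\<close>, \<open>sv\<close> and \<open>uv\<close> (\<open>hamiltonian_path_with_end\<close>).
\<close>

section \<open>Weighted colourings of perfect graphs\<close>

text \<open>
  Perfection for a relation on a vertex set, with an arbitrary upper bound \<open>n\<close> on the clique sizes
  instead of the clique number. This is equivalent, passes to subsets immediately, and no maxima have
  to be computed: a bound on the cliques is all that the counting arguments produce.
\<close>

definition perfect_on :: "('a \<Rightarrow> 'a \<Rightarrow> bool) \<Rightarrow> 'a set \<Rightarrow> bool" where
  "perfect_on E V \<longleftrightarrow>
     (\<forall>W\<subseteq>V. \<forall>n. (\<forall>K\<subseteq>W. pairwise E K \<longrightarrow> card K \<le> n) \<longrightarrow>
        (\<exists>c. c ` W \<subseteq> {..<n} \<and> (\<forall>u\<in>W. \<forall>v\<in>W. E u v \<longrightarrow> c u \<noteq> c v)))"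

lemma perfect_on_subset: "perfect_on E V \<Longrightarrow> W \<subseteq> V \<Longrightarrow> perfect_on E W"
  unfolding perfect_on_def by (meson order_trans)

abbreviation stable :: "('a \<Rightarrow> 'a \<Rightarrow> bool) \<Rightarrow> 'a set \<Rightarrow> bool" where
  "stable E A \<equiv> pairwise (\<lambda>u v. \<not> E u v) A"

definition maximum_stable :: "('a \<Rightarrow> 'a \<Rightarrow> bool) \<Rightarrow> 'a set \<Rightarrow> 'a set \<Rightarrow> bool" where
  "maximum_stable E V A \<longleftrightarrow>
     A \<subseteq> V \<and> stable E A \<and> (\<forall>B\<subseteq>V. stable E B \<longrightarrow> card B \<le> card A)"

lemma card_clique_Int_stable_le_1:
  assumes "pairwise E K" "stable E A"
  shows "card (K \<inter> A) \<le> 1"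
proof (cases "finite (K \<inter> A)")
  case True
  have "x = y" if "x \<in> K \<inter> A" "y \<in> K \<inter> A" for x y
    using assms that unfolding pairwise_def by blast
  then show ?thesis
    using True by (metis One_nat_def card_le_Suc0_iff_eq)
qed simp

text \<open>
  Double counting: with vertex multiplicities as weights, the weight of \<open>K\<close> is the number of its
  incidences with the listed sets.
\<close>

lemma sum_length_filter_mem:
  assumes "finite K"
  shows "(\<Sum>v\<in>K. length (filter (\<lambda>A. v \<in> A) As)) = (\<Sum>A\<leftarrow>As. card (K \<inter> A))"
proof (induction As)
  case (Cons A As)
  have "(\<Sum>v\<in>K. length (filter (\<lambda>B. v \<in> B) (A # As)))
      = (\<Sum>v\<in>K. (if v \<in> A then 1 else 0) + length (filter (\<lambda>B. v \<in> B) As))"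
    by (rule sum.cong) auto
  also have "\<dots> = card (K \<inter> A) + (\<Sum>A\<leftarrow>As. card (K \<inter> A))"
    using assms Cons by (simp add: sum.distrib sum.If_cases Int_def)
  finally show ?case by simp
qed simp

lemma sum_list_le_length_mult:
  fixes f :: "'a \<Rightarrow> nat"
  assumes "\<And>x. x \<in> set xs \<Longrightarrow> f x \<le> m"
  shows "(\<Sum>x\<leftarrow>xs. f x) \<le> length xs * m"
  using assms by (induction xs) (auto intro: add_mono)

lemma length_filter_class_of_colouring:
  assumes "c v < n"
  shows "length (filter (\<lambda>A. v \<in> A) (map (\<lambda>i. {u\<in>W. c u = i}) [0..<n])) = (if v \<in> W then 1 else 0)"
proof -
  have "length (filter (\<lambda>A. v \<in> A) (map (\<lambda>i. {u\<in>W. c u = i}) [0..<n])) =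
      card {i. i < n \<and> v \<in> W \<and> c v = i}"
    by (simp add: filter_map o_def length_filter_conv_card) (metis add.left_neutral nth_upt)
  also have "{i. i < n \<and> v \<in> W \<and> c v = i} = (if v \<in> W then {c v} else {})"
    using assms by auto
  finally show ?thesis by simp
qed

text \<open>
  The replication lemma in weighted form: if every clique has weight at most \<open>n\<close>, then \<open>n\<close> stable sets
  cover each vertex as often as its weight says. For weights at most \<open>1\<close> this is a colouring of
  an induced subgraph. The classical proof proceeds by replacing a vertex by two adjacent copies; here
  one unit of weight is added to a vertex \<open>x\<close> of positive weight (\<open>w'\<close> are the weights before this).
  Let \<open>A\<close> be a stable set through \<open>x\<close> in a cover by \<open>n\<close> sets for the weights \<open>w'\<close>. After one unit of
  weight is taken from \<open>w'\<close> at each vertex of \<open>A - {x}\<close>, every clique has weight at most \<open>n - 1\<close>: a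
  clique through \<open>x\<close> had this already, because its weight increases with that of \<open>x\<close>; a clique missing
  \<open>A\<close> meets only the other sets of the cover, each at most once; and the remaining cliques lose a unit.
  So \<open>n - 1\<close> sets suffice for these reduced weights, and adding \<open>A\<close> restores the units at \<open>A - {x}\<close> and
  supplies the additional one at \<open>x\<close>.
\<close>

lemma weighted_colouring:
  fixes w :: "'a \<Rightarrow> nat"
  assumes "finite V" "perfect_on E V"
    and "\<And>K. K \<subseteq> V \<Longrightarrow> pairwise E K \<Longrightarrow> sum w K \<le> n"
  shows "\<exists>As. length As = n \<and> (\<forall>A\<in>set As. A \<subseteq> V \<and> stable E A) \<and>
           (\<forall>v\<in>V. length (filter (\<lambda>A. v \<in> A) As) = w v)"
  using assms(3)
proof (induction "sum w V" arbitrary: w n rule: less_induct)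
  case less
  note fin = finite_subset[OF _ \<open>finite V\<close>]
  show ?case
  proof (cases "\<forall>v\<in>V. w v \<le> 1")
    case True
    define W where "W = {v\<in>V. w v = 1}"
    have "card K \<le> n" if "K \<subseteq> W" "pairwise E K" for K
    proof -
      have "sum w K = card K"
        using that by (simp add: W_def subset_iff)
      moreover have "K \<subseteq> V"
        using that by (auto simp: W_def)
      ultimately show ?thesis
        using less.prems that by metis
    qed
    moreover have "W \<subseteq> V"
      by (auto simp: W_def)
    ultimately obtain c where c: "c ` W \<subseteq> {..<n}" "\<forall>u\<in>W. \<forall>v\<in>W. E u v \<longrightarrow> c u \<noteq> c v"
      using \<open>perfect_on E V\<close> unfolding perfect_on_def by meson
    define As where "As = map (\<lambda>i. {u\<in>W. c u = i}) [0..<n]"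
    have "length (filter (\<lambda>A. v \<in> A) As) = w v" if "v \<in> V" for v
    proof (cases "v \<in> W")
      case True
      then show ?thesis
        using c length_filter_class_of_colouring[of c v n W] by (auto simp: As_def W_def)
    next
      case False
      then have "w v = 0"
        using \<open>\<forall>v\<in>V. w v \<le> 1\<close> that by (auto simp: W_def le_Suc_eq)
      then show ?thesis
        using False by (auto simp: As_def filter_empty_conv)
    qed
    moreover have "\<forall>A\<in>set As. A \<subseteq> V \<and> stable E A"
      using c(2) \<open>W \<subseteq> V\<close> unfolding pairwise_def by (auto simp: As_def) metis
    moreover have "length As = n"
      by (simp add: As_def)
    ultimately show ?thesis
      by blast
  next
    case False
    then obtain x where x: "x \<in> V" "2 \<le> w x"
      by force
    define w' where "w' = w(x := w x - 1)"
    have w'_other: "sum w' K = sum w K" if "x \<notin> K" for K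
      using that by (intro sum.cong) (auto simp: w'_def)
    have w'_x: "sum w K = Suc (sum w' K)" if "x \<in> K" "K \<subseteq> V" for K
    proof -
      have "sum w K = w x + sum w (K - {x})" "sum w' K = w' x + sum w' (K - {x})"
        using that fin by (auto intro: sum.remove)
      then show ?thesis
        using x w'_other[of "K - {x}"] by (simp add: w'_def)
    qed
    have clique_w': "sum w' K \<le> n" if "K \<subseteq> V" "pairwise E K" for K
      using w'_other[of K] w'_x[of K] that less.prems[OF that] by (cases "x \<in> K") auto
    obtain As where As: "length As = n" "\<forall>A\<in>set As. A \<subseteq> V \<and> stable E A"
      "\<forall>v\<in>V. length (filter (\<lambda>A. v \<in> A) As) = w' v"
      using less.hyps[of w' n] clique_w' w'_x[of V] x by auto
    have "0 < length (filter (\<lambda>A. x \<in> A) As)"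
      using As x by (simp add: w'_def)
    then obtain A where A: "A \<in> set As" "x \<in> A"
      by (auto simp: filter_empty_conv)
    have A_w': "0 < w' v" if "v \<in> A" for v
    proof -
      have "v \<in> V" "A \<in> set (filter (\<lambda>A. v \<in> A) As)"
        using As A that by auto
      then show ?thesis
        using As by (metis length_pos_if_in_set)
    qed
    define w'' where "w'' v = (if v \<in> A - {x} then w' v - 1 else w' v)" for v
    have le: "w'' v \<le> w' v" for v
      by (simp add: w''_def)
    have clique_w'': "sum w'' K \<le> n - 1" if K: "K \<subseteq> V" "pairwise E K" for K
    proof -
      have "finite K"
        using K fin by blast
      have "sum w'' K \<le> sum w' K"
        using le by (rule sum_mono)
      consider "x \<in> K" | y where "x \<notin> K" "y \<in> K \<inter> A" | "K \<inter> A = {}"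
        by blast
      then show ?thesis
      proof cases
        case 1
        then show ?thesis
          using w'_x[of K] less.prems[OF K] K \<open>sum w'' K \<le> sum w' K\<close> by auto
      next
        case 2
        then have "w'' y < w' y"
          using A_w'[of y] by (auto simp: w''_def)
        then have "sum w'' K < sum w' K"
          using 2 le \<open>finite K\<close> by (intro sum_strict_mono_ex1) auto
        then show ?thesis
          using clique_w'[OF K] by linarith
      next
        case 3
        have "sum w' K = (\<Sum>v\<in>K. length (filter (\<lambda>A. v \<in> A) As))"
          using As K by (intro sum.cong) auto
        also have "\<dots> = (\<Sum>B\<leftarrow>As. card (K \<inter> B))"
          using \<open>finite K\<close> by (rule sum_length_filter_mem)
        also have "\<dots> = card (K \<inter> A) + (\<Sum>B\<leftarrow>remove1 A As. card (K \<inter> B))"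
          by (rule sum_list_map_remove1[OF \<open>A \<in> set As\<close>])
        also have "\<dots> \<le> length (remove1 A As) * 1"
        proof -
          have "card (K \<inter> B) \<le> 1" if "B \<in> set (remove1 A As)" for B
            using As(2) card_clique_Int_stable_le_1[OF K(2)] that
            by (meson notin_set_remove1)
          then show ?thesis
            using 3 sum_list_le_length_mult[of "remove1 A As" "\<lambda>B. card (K \<inter> B)" 1] by simp
        qed
        finally show ?thesis
          using \<open>sum w'' K \<le> sum w' K\<close> As A by (simp add: length_remove1)
      qed
    qed
    have "sum w'' V \<le> sum w' V"
      using le by (rule sum_mono)
    then have "sum w'' V < sum w V"
      using w'_x[of V] x by auto
    then obtain Bs where Bs: "length Bs = n - 1" "\<forall>B\<in>set Bs. B \<subseteq> V \<and> stable E B"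
      "\<forall>v\<in>V. length (filter (\<lambda>B. v \<in> B) Bs) = w'' v"
      using less.hyps[of w'' "n - 1"] clique_w'' by blast
    have "length (filter (\<lambda>B. v \<in> B) (A # Bs)) = w v" if "v \<in> V" for v
      using Bs that A_w'[of v] x A by (auto simp: w''_def w'_def)
    moreover have "0 < n"
      using As A by (cases As) auto
    ultimately show ?thesis
      using Bs As A by (intro exI[of _ "A # Bs"]) auto
  qed
qed

section \<open>Partitioning a perfect graph into cliques\<close>

lemma exists_maximum_stable:
  assumes "finite V"
  obtains A where "maximum_stable E V A"
proof -
  have "\<exists>A. (A \<subseteq> V \<and> stable E A) \<and> (\<forall>B. B \<subseteq> V \<and> stable E B \<longrightarrow> card B \<le> card A)"
    by (rule ex_has_greatest_nat[of _ "{}" _ "Suc (card V)"])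
      (auto simp: less_Suc_eq_le intro: card_mono assms)
  then show thesis
    using that unfolding maximum_stable_def by blast
qed

lemma card_maximum_stable_eq:
  "maximum_stable E V A \<Longrightarrow> maximum_stable E V B \<Longrightarrow> card A = card B"
  unfolding maximum_stable_def by (simp add: le_antisym)

text \<open>
  Let \<open>\<alpha>\<close> be the size of the maximum stable sets and \<open>m\<close> the number of cliques, and suppose every clique
  \<open>K\<close> is missed by some maximum stable set \<open>f K\<close>. Weight each vertex by the number of sets \<open>f K\<close> containing
  it; the total weight is \<open>m * \<alpha>\<close>. A clique \<open>X\<close> meets each \<open>f K\<close> at most once and misses \<open>f X\<close>, so
  its weight is at most \<open>m - 1\<close>. Hence \<open>m - 1\<close> stable sets realise the weights, and their total size is at
  most \<open>(m - 1) * \<alpha>\<close>.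
\<close>

lemma clique_meeting_maximum_stable_sets:
  assumes "finite V" "perfect_on E V" "V \<noteq> {}"
  obtains K where "K \<subseteq> V" "pairwise E K" "\<And>A. maximum_stable E V A \<Longrightarrow> K \<inter> A \<noteq> {}"
proof (rule ccontr)
  assume "\<not> thesis"
  then have "\<forall>K. K \<subseteq> V \<and> pairwise E K \<longrightarrow> (\<exists>A. maximum_stable E V A \<and> K \<inter> A = {})"
    using that by blast
  then obtain f where f: "\<And>K. K \<subseteq> V \<Longrightarrow> pairwise E K \<Longrightarrow> maximum_stable E V (f K) \<and> K \<inter> f K = {}"
    by metis
  define C where "C = {K. K \<subseteq> V \<and> pairwise E K}"
  have "finite C"
    using \<open>finite V\<close> by (simp add: C_def)
  define w where "w v = card {K\<in>C. v \<in> f K}" for v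
  have sum_w: "sum w X = (\<Sum>K\<in>C. card (X \<inter> f K))" if "finite X" for X
  proof -
    have "sum w X = (\<Sum>v\<in>X. \<Sum>K\<in>C. if v \<in> f K then 1 else 0)"
      using \<open>finite C\<close> by (simp add: w_def sum.If_cases Int_def)
    also have "\<dots> = (\<Sum>K\<in>C. \<Sum>v\<in>X. if v \<in> f K then 1 else 0)"
      by (rule sum.swap)
    also have "\<dots> = (\<Sum>K\<in>C. card (X \<inter> f K))"
      using that by (simp add: sum.If_cases Int_def)
    finally show ?thesis .
  qed
  have "sum w X \<le> card C - 1" if X: "X \<subseteq> V" "pairwise E X" for X
  proof -
    have "X \<in> C" "finite X"
      using X \<open>finite V\<close> by (auto simp: C_def intro: finite_subset)
    have "sum w X = card (X \<inter> f X) + (\<Sum>K\<in>C - {X}. card (X \<inter> f K))"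
      using \<open>X \<in> C\<close> \<open>finite C\<close> \<open>finite X\<close> by (simp add: sum_w sum.remove)
    also have "\<dots> \<le> (\<Sum>K\<in>C - {X}. 1)"
      using f X card_clique_Int_stable_le_1[OF X(2)]
      by (simp del: sum_constant) (intro sum_mono, auto simp: C_def maximum_stable_def)
    finally show ?thesis
      using \<open>X \<in> C\<close> by simp
  qed
  then obtain As where As: "length As = card C - 1" "\<forall>A\<in>set As. A \<subseteq> V \<and> stable E A"
    "\<forall>v\<in>V. length (filter (\<lambda>A. v \<in> A) As) = w v"
    using weighted_colouring[OF assms(1,2), of w "card C - 1"] by blast
  obtain S where S: "maximum_stable E V S"
    using exists_maximum_stable[OF \<open>finite V\<close>] .
  have "card (V \<inter> f K) = card S" if "K \<in> C" for K
  proof -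
    have "maximum_stable E V (f K)"
      using f that by (auto simp: C_def)
    then have "V \<inter> f K = f K"
      by (auto simp: maximum_stable_def)
    then show ?thesis
      using card_maximum_stable_eq[OF \<open>maximum_stable E V (f K)\<close> S] by simp
  qed
  then have "card C * card S = sum w V"
    using \<open>finite V\<close> by (simp add: sum_w)
  also have "\<dots> = (\<Sum>v\<in>V. length (filter (\<lambda>A. v \<in> A) As))"
    using As by simp
  also have "\<dots> = (\<Sum>A\<leftarrow>As. card (V \<inter> A))"
    using \<open>finite V\<close> by (rule sum_length_filter_mem)
  also have "\<dots> \<le> length As * card S"
  proof (rule sum_list_le_length_mult)
    fix A assume "A \<in> set As"
    then have "A \<subseteq> V" "stable E A"
      using As by auto
    moreover have "V \<inter> A = A"
      using \<open>A \<subseteq> V\<close> by blast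
    ultimately show "card (V \<inter> A) \<le> card S"
      using S by (simp add: maximum_stable_def)
  qed
  finally have "card C * card S \<le> (card C - 1) * card S"
    using As by simp
  moreover have "0 < card C"
    using \<open>finite C\<close> by (auto simp: C_def card_gt_0_iff intro: exI[of _ "{}"])
  moreover have "1 \<le> card S"
  proof -
    obtain x where "x \<in> V"
      using \<open>V \<noteq> {}\<close> by blast
    then have "card {x} \<le> card S"
      using S unfolding maximum_stable_def by (metis empty_subsetI insert_subset pairwise_singleton)
    then show ?thesis by simp
  qed
  ultimately show False
    by (simp only: mult_le_cancel2) auto
qed

text \<open>
  Removing a clique that meets every maximum stable set lowers the stability number, so the remaining
  part of \<open>S\<close> is a maximum stable set of the remaining graph.
\<close>

lemma clique_partition:
  assumes "finite V" "perfect_on E V" "maximum_stable E V S"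
  shows "\<exists>Q. partition_on V Q \<and> (\<forall>K\<in>Q. pairwise E K \<and> (\<exists>s. K \<inter> S = {s}))"
  using assms
proof (induction V arbitrary: S rule: finite_psubset_induct)
  case (psubset V)
  show ?case
  proof (cases "V = {}")
    case True
    then show ?thesis
      by (intro exI[of _ "{}"]) (simp add: partition_on_empty)
  next
    case False
    then obtain K where K: "K \<subseteq> V" "pairwise E K"
      and meets: "\<And>A. maximum_stable E V A \<Longrightarrow> K \<inter> A \<noteq> {}"
      using clique_meeting_maximum_stable_sets[OF psubset.hyps(1) psubset.prems(1)] by metis
    have S: "S \<subseteq> V" "stable E S" "\<And>B. B \<subseteq> V \<Longrightarrow> stable E B \<Longrightarrow> card B \<le> card S"
      using psubset.prems by (auto simp: maximum_stable_def)
    have "finite S"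
      using S(1) psubset.hyps(1) by (rule finite_subset)
    obtain s where s: "s \<in> K \<inter> S"
      using meets[OF psubset.prems(2)] by blast
    have KS: "K \<inter> S = {s}"
      using K(2) S(2) s unfolding pairwise_def by blast
    have "maximum_stable E (V - K) (S - K)"
      unfolding maximum_stable_def
    proof (intro conjI allI impI)
      show "S - K \<subseteq> V - K"
        using S by blast
      show "stable E (S - K)"
        using S by (auto intro: pairwise_subset)
      fix B assume B: "B \<subseteq> V - K" "stable E B"
      have "\<not> maximum_stable E V B"
        using B meets by blast
      then have "card B < card S"
        using B S unfolding maximum_stable_def by (metis Diff_subset le_neq_implies_less subset_trans)
      moreover have "S - K = S - {s}"
        using KS by blast
      ultimately show "card B \<le> card (S - K)"
        using s \<open>finite S\<close> by simp
    qed
    moreover have "V - K \<subset> V"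
      using K s by blast
    ultimately obtain Q where Q: "partition_on (V - K) Q"
      "\<forall>L\<in>Q. pairwise E L \<and> (\<exists>s. L \<inter> (S - K) = {s})"
      using psubset.IH perfect_on_subset[OF psubset.prems(1)] by blast
    have "L \<inter> (S - K) = L \<inter> S" if "L \<in> Q" for L
      using Q(1) that by (auto dest: partition_onD1)
    then have "\<forall>L\<in>insert K Q. pairwise E L \<and> (\<exists>s. L \<inter> S = {s})"
      using Q(2) K(2) KS by fastforce
    moreover have "partition_on V (insert K Q)"
      using Q(1) K(1) s by (intro partition_onI) (auto simp: disjnt_def dest: partition_onD1
          partition_onD3 disjointD[OF partition_onD2])
    ultimately show ?thesis
      by blast
  qed
qed

section \<open>Hamiltonian paths in cliques\<close>

text \<open>
  The new vertex \<open>v\<close> is inserted directly after the last vertex of the path that has an arc to it. The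
  next vertex of the path, if there is one, has no arc to \<open>v\<close> and therefore an arc from \<open>v\<close>.
\<close>

lemma insert_vertex_in_path:
  assumes "distinct p" "successively R p" "v \<notin> set p"
    and "\<And>x. x \<in> set p \<Longrightarrow> R x v \<or> R v x" "\<exists>x\<in>set p. R x v"
  shows "\<exists>q. distinct q \<and> set q = insert v (set p) \<and> hd q = hd p \<and> successively R q"
proof -
  obtain ys x zs where p: "p = ys @ x # zs" "R x v" "\<forall>z\<in>set zs. \<not> R z v"
    using split_list_last_prop[OF assms(5)] by blast
  have "zs = [] \<or> R v (hd zs)"
    using p assms(4)[of "hd zs"] by (cases zs) auto
  then have "successively R (ys @ x # v # zs)"
    using assms(2) p by (auto simp: successively_append_iff successively_Cons)
  moreover have "hd (ys @ x # v # zs) = hd p"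
    using p by (cases ys) auto
  ultimately show ?thesis
    using assms(1,3) p by (intro exI[of _ "ys @ x # v # zs"]) auto
qed

text \<open>
  Reachability of all vertices of \<open>K\<close> from \<open>s\<close> is expressed through cuts: every proper subset of \<open>K\<close>
  that contains \<open>s\<close> is left by an arc. Applied to the vertex set of a path, this yields a vertex to insert.
\<close>

lemma hamiltonian_path_from:
  assumes "finite K" "s \<in> K" "pairwise (\<lambda>u v. R u v \<or> R v u) K"
    and cut: "\<And>X. s \<in> X \<Longrightarrow> X \<subset> K \<Longrightarrow> \<exists>x\<in>X. \<exists>y\<in>K - X. R x y"
  shows "\<exists>p. distinct p \<and> set p = K \<and> hd p = s \<and> successively R p"
proof -
  have path: "\<exists>p. distinct p \<and> set p \<subseteq> K \<and> hd p = s \<and> successively R p \<and> card (set p) = Suc n"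
    if "n < card K" for n
    using that
  proof (induction n)
    case 0
    then show ?case
      using \<open>s \<in> K\<close> by (intro exI[of _ "[s]"]) auto
  next
    case (Suc n)
    then obtain p where p: "distinct p" "set p \<subseteq> K" "hd p = s" "successively R p"
      "card (set p) = Suc n"
      by auto
    have "s \<in> set p" "set p \<subset> K"
      using p Suc.prems by (auto intro: hd_in_set[of p])
    then obtain x v where v: "x \<in> set p" "v \<in> K - set p" "R x v"
      using cut[of "set p"] by blast
    have "R y v \<or> R v y" if "y \<in> set p" for y
    proof -
      have "y \<in> K" "v \<in> K" "y \<noteq> v"
        using p(2) v that by auto
      then show ?thesis
        using assms(3) by (auto simp: pairwise_def)
    qed
    then have "\<exists>q. distinct q \<and> set q = insert v (set p) \<and> hd q = hd p \<and> successively R q"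
      using p v by (intro insert_vertex_in_path) auto
    then obtain q where "distinct q" "set q = insert v (set p)" "hd q = hd p" "successively R q"
      by blast
    then show ?case
      using p v by (intro exI[of _ q]) auto
  qed
  have "0 < card K"
    using \<open>finite K\<close> \<open>s \<in> K\<close> by (auto simp: card_gt_0_iff)
  then obtain p where p: "distinct p" "set p \<subseteq> K" "hd p = s" "successively R p"
    "card (set p) = card K"
    using path[of "card K - 1"] by auto
  moreover have "set p = K"
    using \<open>finite K\<close> p(2,5) by (rule card_subset_eq)
  ultimately show ?thesis
    by blast
qed

text \<open>
  Suppose no arc leaves \<open>X\<close> and no arc enters \<open>Y\<close>, where \<open>X\<close> and \<open>Y\<close> are proper subsets of \<open>K\<close>
  containing \<open>s\<close>. Then \<open>u \<in> K - X\<close> and \<open>v \<in> K - Y\<close> are joined to \<open>s\<close> by the arcs \<open>us\<close> and \<open>sv\<close> only.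
  As \<open>sv\<close> does not leave \<open>X\<close>, the vertex \<open>v\<close> lies in \<open>X\<close>, so that \<open>vu\<close> is not an
  arc either, and \<open>u\<close>, \<open>s\<close>, \<open>v\<close> form a transitive triangle.
\<close>

lemma hamiltonian_path_with_end:
  assumes "finite K" "s \<in> K" "pairwise (\<lambda>u v. R u v \<or> R v u) K"
    and no_transitive_triangle: "\<And>u v. u \<in> K \<Longrightarrow> v \<in> K \<Longrightarrow> u \<noteq> s \<Longrightarrow> v \<noteq> s \<Longrightarrow> u \<noteq> v \<Longrightarrow>
      R u s \<Longrightarrow> R s v \<Longrightarrow> R u v \<Longrightarrow> R s u \<or> R v s \<or> R v u"
  shows "\<exists>p. distinct p \<and> set p = K \<and> s \<in> {hd p, last p} \<and> successively R p"
proof (cases "\<forall>X. s \<in> X \<longrightarrow> X \<subset> K \<longrightarrow> (\<exists>x\<in>X. \<exists>y\<in>K - X. R x y)")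
  case True
  then have "\<exists>p. distinct p \<and> set p = K \<and> hd p = s \<and> successively R p"
    using assms(1-3) by (intro hamiltonian_path_from) auto
  then show ?thesis
    by auto
next
  case False
  then obtain X where X: "s \<in> X" "X \<subset> K" "\<And>x y. x \<in> X \<Longrightarrow> y \<in> K - X \<Longrightarrow> \<not> R x y"
    by blast
  then obtain u where u: "u \<in> K - X"
    by blast
  have "\<exists>y\<in>Y. \<exists>v\<in>K - Y. R v y" if Y: "s \<in> Y" "Y \<subset> K" for Y
  proof (rule ccontr)
    assume no_arc: "\<not> ?thesis"
    obtain v where v: "v \<in> K - Y"
      using Y by blast
    have "u \<noteq> s" "v \<noteq> s"
      using u v X Y by auto
    have "\<not> R s u" "\<not> R v s"
      using X u v Y no_arc by blast+
    then have "R u s" "R s v"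
      using assms(2,3) u v \<open>u \<noteq> s\<close> \<open>v \<noteq> s\<close> unfolding pairwise_def by blast+
    then have "v \<in> X"
      using X v by blast
    then have "u \<noteq> v" "\<not> R v u"
      using X u by auto
    then have "R u v"
      using assms(3) u v unfolding pairwise_def by blast
    then show False
      using no_transitive_triangle[of u v] u v \<open>u \<noteq> s\<close> \<open>v \<noteq> s\<close> \<open>u \<noteq> v\<close> \<open>R u s\<close> \<open>R s v\<close>
        \<open>\<not> R s u\<close> \<open>\<not> R v s\<close> \<open>\<not> R v u\<close> by blast
  qed
  moreover have "pairwise (\<lambda>u v. R v u \<or> R u v) K"
    using assms(3) by (auto simp: pairwise_def)
  ultimately have "\<exists>p. distinct p \<and> set p = K \<and> hd p = s \<and> successively (\<lambda>u v. R v u) p"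
    using assms(1,2) by (intro hamiltonian_path_from) auto
  then obtain p where "distinct p" "set p = K" "hd p = s" "successively (\<lambda>u v. R v u) p"
    by blast
  then show ?thesis
    using \<open>s \<in> K\<close> by (intro exI[of _ "rev p"]) (auto simp: last_rev)
qed

section \<open>From digraphs to relations\<close>

lemma dominates_induce_subgraph_iff:
  "u \<rightarrow>\<^bsub>G \<restriction> W\<^esub> v \<longleftrightarrow> u \<rightarrow>\<^bsub>G\<^esub> v \<and> u \<in> W \<and> v \<in> W"
  by (auto simp: arcs_ends_conv)

lemma set_vwalk_arcs_subset_iff:
  "set (vwalk_arcs p) \<subseteq> arcs_ends G \<longleftrightarrow> successively (\<lambda>u v. u \<rightarrow>\<^bsub>G\<^esub> v) p"
  by (induction p rule: vwalk_arcs.induct) auto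

lemma perfect_on_if_perfect_graph:
  assumes "digraph D" "perfect_graph (underlying_graph D)"
  shows "perfect_on (adjacent D) (verts D)"
  unfolding perfect_on_def
proof (intro allI impI)
  fix W n
  assume W: "W \<subseteq> verts D" and n: "\<forall>K\<subseteq>W. pairwise (adjacent D) K \<longrightarrow> card K \<le> n"
  define H where "H = underlying_graph D \<restriction> W"
  interpret digraph D by fact
  interpret U: graph "underlying_graph D"
    using assms(1) by (rule graph_underlying_graph)
  have "finite W"
    using W finite_verts by (rule finite_subset)
  have verts_H: "verts H = W"
    by (simp add: H_def)
  have adj_H: "adjacent H u v \<longleftrightarrow> adjacent D u v \<and> u \<in> W \<and> v \<in> W" for u v
    unfolding H_def adjacent_def[of "underlying_graph D \<restriction> W"] dominates_induce_subgraph_iff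
      arcs_ends_underlying_graph
    by (auto simp: adjacent_def)
  have "clique_number H \<le> n"
    unfolding clique_number_def
  proof (subst Max_le_iff)
    have "finite (card ` Pow W)"
      using \<open>finite W\<close> by simp
    then show "finite {card K |K. clique_set H K}"
      by (rule rev_finite_subset) (auto simp: clique_set_def verts_H)
    show "{card K |K. clique_set H K} \<noteq> {}"
      by (auto simp: clique_set_def intro: exI[of _ "{}"])
    have "card K \<le> n" if "clique_set H K" for K
    proof -
      have "pairwise (adjacent D) K" "K \<subseteq> W"
        using that by (auto simp: clique_set_def pairwise_def verts_H adj_H)
      then show ?thesis
        using n by blast
    qed
    then show "\<forall>a\<in>{card K |K. clique_set H K}. a \<le> n"
      by blast
  qed
  moreover have "induced_subgraph H (underlying_graph D)"
    unfolding H_def using W by (intro U.induced_induce) simp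
  then have "chromatic_number H = clique_number H"
    using assms(2) by (simp add: perfect_graph_def)
  moreover have "\<exists>c. proper_colouring H c \<and> c ` verts H \<subseteq> {..<chromatic_number H}"
    unfolding chromatic_number_def
  proof (rule LeastI_ex)
    \<comment> \<open>Numbering the vertices injectively shows that some number of colours suffices.\<close>
    obtain c :: "'a \<Rightarrow> nat" and m where c: "c ` W = {i. i < m}" "inj_on c W"
      using finite_imp_inj_to_nat_seg[OF \<open>finite W\<close>] by blast
    have "\<not> adjacent D u u" for u
      using adj_not_same by (auto simp: adjacent_def)
    then have "proper_colouring H c"
      unfolding proper_colouring_def verts_H adj_H using c(2) by (metis inj_onD)
    then show "\<exists>n c. proper_colouring H c \<and> c ` verts H \<subseteq> {..<n}"
      using c(1) verts_H by blast
  qed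
  ultimately obtain c where "proper_colouring H c" "c ` W \<subseteq> {..<n}"
    unfolding verts_H by (metis lessThan_subset_iff order_trans)
  then show "\<exists>c. c ` W \<subseteq> {..<n} \<and> (\<forall>u\<in>W. \<forall>v\<in>W. adjacent D u v \<longrightarrow> c u \<noteq> c v)"
    unfolding proper_colouring_def verts_H adj_H by blast
qed

text \<open>
  In a transitive tournament with arcs \<open>us\<close>, \<open>sv\<close> and \<open>uv\<close> the vertex \<open>u\<close> is a source and \<open>v\<close> is a sink;
  these two are the consecutive vertices required by a blocking odd cycle.
\<close>

lemma blocking_odd_cycle_if_transitive_triangle:
  fixes D :: "('a, 'b) pre_digraph"
  assumes "digraph D" "u \<in> verts D" "s \<in> verts D" "v \<in> verts D" "u \<noteq> s" "v \<noteq> s" "u \<noteq> v"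
    and arcs: "u \<rightarrow>\<^bsub>D\<^esub> s" "s \<rightarrow>\<^bsub>D\<^esub> v" "u \<rightarrow>\<^bsub>D\<^esub> v" "\<not> s \<rightarrow>\<^bsub>D\<^esub> u" "\<not> v \<rightarrow>\<^bsub>D\<^esub> s" "\<not> v \<rightarrow>\<^bsub>D\<^esub> u"
  shows "induced_subgraph (D \<restriction> {u, s, v}) D \<and> blocking_odd_cycle (D \<restriction> {u, s, v})"
proof
  interpret digraph D by fact
  define C where "C = D \<restriction> {u, s, v}"
  have sub: "induced_subgraph C D"
    unfolding C_def using assms by (intro induced_induce) auto
  then show "induced_subgraph (D \<restriction> {u, s, v}) D"
    by (simp add: C_def)
  have irrefl: "\<not> x \<rightarrow>\<^bsub>D\<^esub> x" for x
    using adj_not_same by blast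
  have arcs_C: "x \<rightarrow>\<^bsub>C\<^esub> y \<longleftrightarrow> (x, y) \<in> {(u, s), (s, v), (u, v)}" for x y
    unfolding C_def dominates_induce_subgraph_iff using arcs irrefl assms(5-7) by auto
  have verts_C: "verts C = {u, s, v}"
    by (simp add: C_def)
  have ends: "arcs_ends (underlying_graph C) = {(u, v), (v, u), (v, s), (s, v), (s, u), (u, s)}"
  proof (rule set_eqI)
    fix e :: "'a \<times> 'a"
    obtain x y where "e = (x, y)"
      by fastforce
    then show "e \<in> arcs_ends (underlying_graph C) \<longleftrightarrow>
        e \<in> {(u, v), (v, u), (v, s), (s, v), (s, u), (u, s)}"
      using arcs_ends_underlying_graph[where G = C and u = x and v = y] by (auto simp: adjacent_def arcs_C)
  qed
  have indices: "{..<length [u, v, s]} = {0, 1, 2}"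
    by auto
  have verts: "verts (underlying_graph C) = {u, s, v}"
    using verts_C by (simp add: mk_symmetric_def)
  have "is_cycle_graph (underlying_graph C) [u, v, s]"
    unfolding is_cycle_graph_def indices ends verts using assms(5-7) by (simp add: insert_commute)
  moreover have "source C u" "sink C v"
    using assms(5-7) by (auto simp: source_def sink_def arcs_C verts_C)
  moreover have "digraph C"
    using sub by (rule digraphI_induced)
  ultimately have "blocking_odd_cycle C"
    unfolding blocking_odd_cycle_def by (intro conjI exI[of _ 1] exI[of _ "[u, v, s]"]) auto
  then show "blocking_odd_cycle (D \<restriction> {u, s, v})"
    by (simp add: C_def)
qed

theorem theorem3p6:
  fixes D :: "('a, 'b) pre_digraph"
  assumes "digraph D"
    and "\<not> (\<exists>C. induced_subgraph C D \<and> blocking_odd_cycle C)"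
    and "perfect_graph (underlying_graph D)"
  shows "BE_diperfect D"
  unfolding BE_diperfect_def BE_property_def
proof (intro allI impI)
  fix H S
  assume H: "induced_subgraph H D" and S: "maximum_stable_set H S"
  interpret digraph D by fact
  let ?V = "verts H"
  have V: "?V \<subseteq> verts D"
    using H by auto
  have "finite ?V"
    using V finite_verts by (rule finite_subset)
  have dom_H: "u \<rightarrow>\<^bsub>H\<^esub> v \<longleftrightarrow> u \<rightarrow>\<^bsub>D\<^esub> v \<and> u \<in> ?V \<and> v \<in> ?V" for u v
    using dominates_induce_subgraph_iff[where G = D and W = ?V] induce_eq_iff_induced[OF H] by metis
  have "stable_set H B \<longleftrightarrow> B \<subseteq> ?V \<and> stable (adjacent D) B" for B
    by (auto simp: stable_set_def pairwise_def adjacent_def dom_H subset_iff)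
  then have "maximum_stable (adjacent D) ?V S"
    using S by (auto simp: maximum_stable_set_def maximum_stable_def)
  then obtain Q where Q: "partition_on ?V Q"
    "\<And>K. K \<in> Q \<Longrightarrow> pairwise (adjacent D) K" "\<And>K. K \<in> Q \<Longrightarrow> \<exists>s. K \<inter> S = {s}"
    using clique_partition[OF \<open>finite ?V\<close> perfect_on_subset[OF perfect_on_if_perfect_graph V]]
      assms(1,3) by metis
  have "\<exists>p. vpath p H \<and> set p = K \<and> (\<exists>x. set p \<inter> S = {x} \<and> x \<in> {hd p, last p})"
    if KQ: "K \<in> Q" for K
  proof -
    have K: "K \<subseteq> ?V" "finite K"
      using partition_onD1[OF Q(1)] KQ \<open>finite ?V\<close> by (auto intro: finite_subset)
    obtain s where s: "K \<inter> S = {s}"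
      using Q(3)[OF KQ] by blast
    then have "s \<in> K"
      by blast
    have "\<exists>p. distinct p \<and> set p = K \<and> s \<in> {hd p, last p} \<and> successively (\<lambda>u v. u \<rightarrow>\<^bsub>H\<^esub> v) p"
    proof (rule hamiltonian_path_with_end[OF \<open>finite K\<close> \<open>s \<in> K\<close>])
      show "pairwise (\<lambda>u v. u \<rightarrow>\<^bsub>H\<^esub> v \<or> v \<rightarrow>\<^bsub>H\<^esub> u) K"
        using Q(2)[OF KQ] K by (auto simp: pairwise_def adjacent_def dom_H subset_iff)
      fix u v
      assume uv: "u \<in> K" "v \<in> K" "u \<noteq> s" "v \<noteq> s" "u \<noteq> v"
        "u \<rightarrow>\<^bsub>H\<^esub> s" "s \<rightarrow>\<^bsub>H\<^esub> v" "u \<rightarrow>\<^bsub>H\<^esub> v"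
      then have "u \<in> ?V" "s \<in> ?V" "v \<in> ?V"
        using K \<open>s \<in> K\<close> by auto
      then show "s \<rightarrow>\<^bsub>H\<^esub> u \<or> v \<rightarrow>\<^bsub>H\<^esub> s \<or> v \<rightarrow>\<^bsub>H\<^esub> u"
        using blocking_odd_cycle_if_transitive_triangle[OF assms(1), of u s v] assms(2) V uv
        unfolding dom_H by blast
    qed
    then obtain p where p: "distinct p" "set p = K" "s \<in> {hd p, last p}"
      "successively (\<lambda>u v. u \<rightarrow>\<^bsub>H\<^esub> v) p"
      by blast
    have "p \<noteq> []"
      using p(2) s by auto
    then have "vpath p H"
      using p K by (auto simp: vpath_def vwalk_def set_vwalk_arcs_subset_iff)
    then show ?thesis
      using p s by blast
  qed
  then obtain f where f: "\<And>K. K \<in> Q \<Longrightarrow> vpath (f K) H" "\<And>K. K \<in> Q \<Longrightarrow> set (f K) = K"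
    "\<And>K. K \<in> Q \<Longrightarrow> \<exists>x. set (f K) \<inter> S = {x} \<and> x \<in> {hd (f K), last (f K)}"
    by metis
  have "set ` f ` Q = Q"
    using f(2) by (simp add: image_image)
  moreover have "inj_on set (f ` Q)"
    using f(2) by (simp add: inj_on_def)
  ultimately have "BE_path_partition H S (f ` Q)"
    unfolding BE_path_partition_def path_partition_def using f(1,3) Q(1) by simp
  then show "\<exists>P. BE_path_partition H S P"
    by blast
qed

end
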